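(* Let $\alpha>-1$, $t\in\mathbb{R}$, and write $\beta_n=\beta_n(t)$. For every integer $n\ge0$ the monic orthogonal polynomial $P_n(z)=P_n(z,t)$ satisfies the second-order differential equation (prime denoting $d/dz$) $$P_n''(z)-\left(\mathrm{v}'(z)+\frac{A_n'(z)}{A_n(z)}\right)P_n'(z)+\left(B_n'(z)-B_n(z)\frac{A_n'(z)}{A_n(z)}+\sum_{j=0}^{n-1}A_j(z)\right)P_n(z)=0,$$ where $$\mathrm{v}'(z)=2tz+\frac{2\alpha z}{1-z^2},\qquad A_n(z)=2t+\frac{2n+1+2\alpha-2t(\beta_n+\beta_{n+1})}{1-z^2},\qquad B_n(z)=\frac{z(n-2t\beta_n)}{1-z^2},$$ and $$\sum_{j=0}^{n-1}A_j(z)=2nt+\frac{n^2-2n(t-\alpha)+2t\beta_n(2t+1-2t\beta_{n+1})}{1-z^2}+\frac{2t(n-2t\beta_n)(n+2\alpha-2t\beta_n)}{\left[2n+1+2\alpha-2t(\beta_n+\beta_{n+1})\right](1-z^2)}.$$ (The identities are for all $z\in\mathbb{C}$ and all parameters for which the denominators occurring do not vanish, i.e. $z\ne\pm1$, $2n+1+2\alpha-2t(\beta_n+\beta_{n+1})\neq0$ and, for the differential equation, $A_n(z)\ne0$.)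
   Context: For $\alpha>-1$ and $t\in\mathbb{R}$ let $w(x,t)=(1-x^2)^{\alpha}e^{-tx^2}$, $x\in[-1,1]$, and $\mathrm{v}=-\ln w$. Let $P_n(x,t)$, $n=0,1,2,\ldots$, be the monic polynomials of degree $n$ orthogonal with respect to $w$: $\int_{-1}^1P_m(x,t)P_n(x,t)w(x,t)\,dx=h_n(t)\delta_{mn}$. Since $w$ is even they satisfy $xP_n(x,t)=P_{n+1}(x,t)+\beta_n(t)P_{n-1}(x,t)$ with $P_0=1$, $P_{-1}=0$ and $\beta_0(t):=0$; for $n\ge1$, $\beta_n(t)=h_n(t)/h_{n-1}(t)$. The functions $A_j(z)$, $j\ge0$, in the sum are given by the displayed formula for $A_n(z)$ with $n$ replaced by $j$; the empty sum ($n=0$) is $0$. *)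

theory Defs
  imports "HOL-Analysis.Analysis" "HOL-Computational_Algebra.Polynomial"
begin

text \<open>Since \<open>0 powr a = 0\<close>, the weight takes the junk value \<open>0\<close> at \<open>\<plusminus>1\<close> for \<open>\<alpha> \<le> 0\<close>; this does
  not affect any integral.\<close>

definition weight :: "real \<Rightarrow> real \<Rightarrow> real \<Rightarrow> real" where
  "weight \<alpha> t x = (1 - x\<^sup>2) powr \<alpha> * exp (- t * x\<^sup>2)"

definition potential :: "real \<Rightarrow> real \<Rightarrow> real \<Rightarrow> real" where
  "potential \<alpha> t x = - ln (weight \<alpha> t x)"

text \<open>\<open>P\<close> is the sequence of monic orthogonal polynomials for the weight and \<open>h n\<close> is the
  squared norm of \<open>P n\<close>.\<close>

definition monic_orthogonal_polys :: "real \<Rightarrow> real \<Rightarrow> (nat \<Rightarrow> real poly) \<Rightarrow> (nat \<Rightarrow> real) \<Rightarrow> bool" where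
  "monic_orthogonal_polys \<alpha> t P h \<longleftrightarrow>
     (\<forall>n. degree (P n) = n \<and> lead_coeff (P n) = 1) \<and>
     (\<forall>m n. ((\<lambda>x. poly (P m) x * poly (P n) x * weight \<alpha> t x)
              has_integral (if m = n then h n else 0)) {-1..1})"

definition rec_coeff :: "(nat \<Rightarrow> real) \<Rightarrow> nat \<Rightarrow> real" where
  "rec_coeff h n = (if n = 0 then 0 else h n / h (n - 1))"

definition complex_eval :: "real poly \<Rightarrow> complex \<Rightarrow> complex" where
  "complex_eval p z = poly (map_poly complex_of_real p) z"

text \<open>The rational continuation to the complex plane of the derivative of \<open>potential\<close> on \<open>(-1, 1)\<close>.\<close>

definition potential_deriv :: "real \<Rightarrow> real \<Rightarrow> complex \<Rightarrow> complex" where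
  "potential_deriv \<alpha> t z =
     2 * complex_of_real t * z + 2 * complex_of_real \<alpha> * z / (1 - z\<^sup>2)"

text \<open>In the following, \<open>\<beta>\<close> is the sequence of recurrence coefficients.\<close>

definition ladder_num :: "real \<Rightarrow> real \<Rightarrow> (nat \<Rightarrow> real) \<Rightarrow> nat \<Rightarrow> real" where
  "ladder_num \<alpha> t \<beta> n = 2 * real n + 1 + 2 * \<alpha> - 2 * t * (\<beta> n + \<beta> (n + 1))"

definition ladder_A :: "real \<Rightarrow> real \<Rightarrow> (nat \<Rightarrow> real) \<Rightarrow> nat \<Rightarrow> complex \<Rightarrow> complex" where
  "ladder_A \<alpha> t \<beta> n z =
     2 * complex_of_real t + complex_of_real (ladder_num \<alpha> t \<beta> n) / (1 - z\<^sup>2)"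

definition ladder_B :: "real \<Rightarrow> (nat \<Rightarrow> real) \<Rightarrow> nat \<Rightarrow> complex \<Rightarrow> complex" where
  "ladder_B t \<beta> n z = z * complex_of_real (real n - 2 * t * \<beta> n) / (1 - z\<^sup>2)"

end

theory Submission
  imports Defs
begin

text \<open>
  Only four properties of the functional \<open>L p = \<integral> p w\<close> matter: it is linear, positive, even, and
  satisfies a Pearson equation. The last one is integration by parts: since
  \<open>(1 - x\<^sup>2) w' = - (2 \<alpha> x + 2 t x (1 - x\<^sup>2)) w\<close> and \<open>(1 - x\<^sup>2) w\<close> vanishes at \<open>\<plusminus>1\<close>
  (this is where \<open>\<alpha> > -1\<close> enters), we have
  \<open>L ((1 - x\<^sup>2) q') = L ((2 (\<alpha> + 1) x + 2 t x (1 - x\<^sup>2)) q)\<close>. Everything else is algebra.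

  Write \<open>R\<^sub>n\<close> for \<open>ladder_num\<close> and \<open>r\<^sub>n = n - 2 t \<beta>\<^sub>n\<close>. The Pearson equation and orthogonality give the
  lowering relation \<open>(1 - x\<^sup>2) P\<^sub>n' = \<beta>\<^sub>n (2 t (1 - x\<^sup>2) + R\<^sub>n) P\<^sub>n\<^sub>-\<^sub>1 - r\<^sub>n x P\<^sub>n\<close>, that is,
  \<open>P\<^sub>n' = \<beta>\<^sub>n A\<^sub>n P\<^sub>n\<^sub>-\<^sub>1 - B\<^sub>n P\<^sub>n\<close> (\<open>lowering_relation\<close>). Taking it at \<open>n - 1\<close> and eliminating
  \<open>P\<^sub>n\<^sub>-\<^sub>2\<close> by the three-term recurrence gives
  \<open>P\<^sub>n\<^sub>-\<^sub>1' = (B\<^sub>n + v') P\<^sub>n\<^sub>-\<^sub>1 - A\<^sub>n\<^sub>-\<^sub>1 P\<^sub>n\<close> (\<open>raising_relation\<close>). Eliminating \<open>P\<^sub>n\<^sub>-\<^sub>1\<close> from these two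
  yields the differential equation with \<open>\<beta>\<^sub>n A\<^sub>n A\<^sub>n\<^sub>-\<^sub>1 - B\<^sub>n\<^sup>2 - v' B\<^sub>n\<close> in place of \<open>\<Sum>\<^sub>j\<^sub><\<^sub>n A\<^sub>j\<close>.

  That the two agree amounts to two identities between the recurrence coefficients,
  \<open>\<beta>\<^sub>n R\<^sub>n R\<^sub>n\<^sub>-\<^sub>1 = r\<^sub>n (r\<^sub>n + 2 \<alpha>)\<close> (\<open>R_product\<close>) and a closed form for \<open>\<Sum>\<^sub>j\<^sub><\<^sub>n R\<^sub>j\<close> (\<open>R_sum\<close>). Differentiating
  the three-term recurrence and inserting the ladder relations produces the difference equation
  \<open>compatibility\<close>; multiplied by \<open>R\<^sub>n = r\<^sub>n\<^sub>+\<^sub>1 + r\<^sub>n + 2 \<alpha>\<close> it telescopes to the first identity, and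
  the second follows by telescoping as well. The first identity also removes the quotient by \<open>R\<^sub>n\<close> from the
  asserted closed form of \<open>\<Sum>\<^sub>j\<^sub><\<^sub>n A\<^sub>j\<close>, which then becomes the second.
\<close>

section \<open>Monic orthogonal families of polynomials\<close>

abbreviation X :: "real poly" where "X \<equiv> [:0, 1:]"

lemma poly_ext:
  fixes p q :: "real poly"
  assumes "\<And>x. poly p x = poly q x"
  shows "p = q"
  using assms by (simp add: poly_eq_poly_eq_iff [symmetric] fun_eq_iff)

lemma coeff_X_mult: "coeff (X * p) k = (if k = 0 then 0 else coeff p (k - 1))"
  by (simp add: coeff_pCons')

lemma coeff_one_minus_X_square_mult:
  "coeff ((1 - X * X) * p) k = coeff p k - (if k < 2 then 0 else coeff p (k - 2))"
  by (auto simp: left_diff_distrib mult.assoc coeff_X_mult numeral_2_eq_2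
      simp del: mult_pCons_left mult_pCons_right)

text \<open>Used twice: to extend integrability against the weight from the \<open>P\<^sub>k\<close> to all polynomials, and to extend
  orthogonality from the \<open>P\<^sub>k\<close> with \<open>k < m\<close> to all polynomials of degree below \<open>m\<close>. The degree bound
  is stated through coefficients so that the zero polynomial and \<open>m = 0\<close> need no special treatment.\<close>

lemma monic_basis_induct:
  fixes P :: "nat \<Rightarrow> real poly"
  assumes degree: "\<And>n. degree (P n) = n" and monic: "\<And>n. lead_coeff (P n) = 1"
    and low: "\<And>i. i \<ge> m \<Longrightarrow> coeff p i = 0"
    and zero: "S 0"
    and step: "\<And>k c q. k < m \<Longrightarrow> S q \<Longrightarrow> S (smult c (P k) + q)"
  shows "S p"
  using low step
proof (induction m arbitrary: p)
  case 0
  then have "p = 0" by (intro poly_eqI) simp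
  then show ?case using zero by simp
next
  case (Suc m)
  define q where "q = p - smult (coeff p m) (P m)"
  have "coeff q i = 0" if "i \<ge> m" for i
  proof (cases "i = m")
    case True
    then show ?thesis using monic [of m] by (simp add: q_def degree)
  next
    case False
    then show ?thesis using that Suc.prems(1) [of i]
      by (simp add: q_def coeff_eq_0 degree)
  qed
  then have "S q" using Suc.IH Suc.prems(2) by simp
  then have "S (smult (coeff p m) (P m) + q)" using Suc.prems(2) by simp
  then show ?case by (simp add: q_def)
qed

locale monic_orthogonal_family =
  fixes L :: "real poly \<Rightarrow> real" and P :: "nat \<Rightarrow> real poly" and h :: "nat \<Rightarrow> real"
  assumes L_add: "L (p + q) = L p + L q"
    and L_smult: "L (smult c p) = c * L p"
    and L_square_pos: "p \<noteq> 0 \<Longrightarrow> L (p * p) > 0"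
    and degree_P [simp]: "degree (P n) = n"
    and lead_coeff_P: "lead_coeff (P n) = 1"
    and orthogonal: "L (P m * P n) = (if m = n then h n else 0)"
begin

lemma L_0 [simp]: "L 0 = 0"
  using L_smult [of 0 0] by simp

lemma L_diff: "L (p - q) = L p - L q"
  using L_add [of "p - q" q] by simp

lemma coeff_P_self [simp]: "coeff (P n) n = 1"
  using lead_coeff_P [of n] by simp

lemma coeff_P_high: "i > n \<Longrightarrow> coeff (P n) i = 0"
  by (simp add: coeff_eq_0)

lemma P_nonzero [simp]: "P n \<noteq> 0"
  using coeff_P_self [of n] by force

lemma P_0: "P 0 = 1"
  by (rule poly_eqI) (auto simp: coeff_P_high coeff_1)

lemma h_pos: "h n > 0"
  using L_square_pos [of "P n"] orthogonal [of n n] by simp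

lemma L_P_mult_low:
  assumes "\<And>i. i \<ge> n \<Longrightarrow> coeff q i = 0"
  shows "L (P n * q) = 0"
  using degree_P lead_coeff_P assms
proof (rule monic_basis_induct [where S = "\<lambda>q. L (P n * q) = 0" and P = P and m = n])
  show "L (P n * (smult c (P k) + q)) = 0" if "k < n" "L (P n * q) = 0" for k c q
    using that by (simp add: distrib_left L_add L_smult orthogonal)
qed simp_all

lemma L_P_mult:
  assumes "\<And>i. i > n \<Longrightarrow> coeff q i = 0"
  shows "L (P n * q) = coeff q n * h n"
proof -
  have "L (P n * (q - smult (coeff q n) (P n))) = 0"
  proof (rule L_P_mult_low)
    fix i assume "i \<ge> n"
    then show "coeff (q - smult (coeff q n) (P n)) i = 0"
      by (cases "i = n") (simp_all add: assms coeff_P_high)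
  qed
  then show ?thesis
    by (simp add: right_diff_distrib L_diff L_smult orthogonal)
qed

text \<open>This turns orthogonality into polynomial identities: a difference of two sides that has degree
  below \<open>n\<close> may be paired with itself, and positivity of \<open>L\<close> forces it to vanish.\<close>

lemma eq_0_if_orthogonal_to_low:
  assumes "\<And>i. i \<ge> n \<Longrightarrow> coeff p i = 0"
    and "\<And>q. (\<And>i. i \<ge> n \<Longrightarrow> coeff q i = 0) \<Longrightarrow> L (p * q) = 0"
  shows "p = 0"
  using assms(2) [OF assms(1)] L_square_pos [of p] by fastforce

lemma rec_coeff_0 [simp]: "rec_coeff h 0 = 0"
  by (simp add: rec_coeff_def)

lemma rec_coeff_Suc_h: "rec_coeff h (Suc n) * h n = h (Suc n)"
  using h_pos [of n] by (simp add: rec_coeff_def)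

end

section \<open>Even functionals and the three-term recurrence\<close>

locale even_orthogonal_family = monic_orthogonal_family +
  assumes L_reflect: "L (pcompose p [:0, -1:]) = L p"
begin

text \<open>This coefficient is all that is needed of the parity of \<open>P\<^sub>n\<close>. Since \<open>L\<close> is invariant under
  \<open>x \<mapsto> -x\<close>, the polynomial \<open>(-1)\<^sup>n P\<^sub>n(-x)\<close> is again monic and orthogonal to all lower degrees, so it
  equals \<open>P\<^sub>n\<close>.\<close>

lemma coeff_P_subleading: "coeff (P (Suc n)) n = 0"
proof -
  define R where "R = smult ((-1) ^ Suc n) (pcompose (P (Suc n)) [:0, -1:])"
  have "P (Suc n) - R = 0"
  proof (rule eq_0_if_orthogonal_to_low [where n = "Suc n"])
    fix i assume "i \<ge> Suc n"
    then show "coeff (P (Suc n) - R) i = 0"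
      by (cases "i = Suc n")
        (simp_all add: R_def coeff_pcompose_linear coeff_P_high power_mult_distrib [symmetric])
  next
    fix q :: "real poly" assume q: "\<And>i. i \<ge> Suc n \<Longrightarrow> coeff q i = 0"
    have refl: "pcompose (pcompose q [:0, -1:]) [:0, -1:] = q"
      by (rule poly_ext) (simp add: poly_pcompose)
    have "L (pcompose (P (Suc n)) [:0, -1:] * q)
        = L (pcompose (P (Suc n) * pcompose q [:0, -1:]) [:0, -1:])"
      by (simp only: pcompose_mult refl)
    also have "\<dots> = L (P (Suc n) * pcompose q [:0, -1:])"
      by (rule L_reflect)
    also have "\<dots> = 0"
      by (rule L_P_mult_low) (simp add: coeff_pcompose_linear q)
    finally show "L ((P (Suc n) - R) * q) = 0"
      using L_P_mult_low [of "Suc n" q] q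
      by (simp add: R_def left_diff_distrib distrib_right L_diff L_add L_smult)
  qed
  then have "coeff (P (Suc n)) n = coeff R n" by simp
  also have "\<dots> = - coeff (P (Suc n)) n"
    by (simp add: R_def coeff_pcompose_linear power_mult_distrib [symmetric])
  finally show ?thesis by simp
qed

lemma P_1: "P (Suc 0) = X"
proof (rule poly_eqI)
  fix i
  show "coeff (P (Suc 0)) i = coeff X i"
    using coeff_P_subleading [of 0] coeff_P_self [of 1] coeff_P_high [of 1 i]
    by (cases "i = 0"; cases "i = 1") (auto simp: coeff_pCons' )
qed

text \<open>The vanishing subleading coefficients bring the difference of the two sides down to degree at
  most \<open>n\<close>, which is also why no multiple of \<open>P\<^sub>n\<^sub>+\<^sub>1\<close> occurs. Pairing with degree at most \<open>n\<close> then fixes the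
  coefficient of \<open>P\<^sub>n\<close> as \<open>h\<^sub>n\<^sub>+\<^sub>1 / h\<^sub>n\<close>.\<close>

lemma three_term_recurrence:
  "X * P (Suc n) = P (Suc (Suc n)) + smult (rec_coeff h (Suc n)) (P n)"
proof -
  define D where "D = X * P (Suc n) - P (Suc (Suc n)) - smult (rec_coeff h (Suc n)) (P n)"
  have "D = 0"
  proof (rule eq_0_if_orthogonal_to_low [where n = "Suc n"])
    fix i assume i: "i \<ge> Suc n"
    consider "i = Suc n" | "i = Suc (Suc n)" | "i > Suc (Suc n)"
      using i by linarith
    then show "coeff D i = 0"
      by cases (simp_all add: D_def coeff_X_mult coeff_P_subleading coeff_P_high
          del: mult_pCons_left)
  next
    fix q :: "real poly" assume q: "\<And>i. i \<ge> Suc n \<Longrightarrow> coeff q i = 0"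
    have "D * q = P (Suc n) * (X * q) - P (Suc (Suc n)) * q
        - smult (rec_coeff h (Suc n)) (P n * q)"
      by (rule poly_ext) (simp add: D_def algebra_simps)
    moreover have "L (P (Suc n) * (X * q)) = coeff q n * h (Suc n)"
      using L_P_mult [of "Suc n" "X * q"] q by (simp add: coeff_X_mult del: mult_pCons_left)
    moreover have "L (P (Suc (Suc n)) * q) = 0"
      using q by (intro L_P_mult_low) simp
    moreover have "L (P n * q) = coeff q n * h n"
      using q by (intro L_P_mult) simp
    ultimately show "L (D * q) = 0"
      using rec_coeff_Suc_h [of n] by (simp add: L_diff L_smult mult.left_commute)
  qed
  then show ?thesis by (simp add: D_def algebra_simps del: mult_pCons_left mult_pCons_right)
qed

end

section \<open>Evaluating real polynomials at complex numbers\<close>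

lemma complex_eval_pCons: "complex_eval (pCons a p) z = complex_of_real a + z * complex_eval p z"
  by (simp add: complex_eval_def map_poly_pCons)

lemma complex_eval_0: "complex_eval 0 z = 0"
  by (simp add: complex_eval_def)

lemma complex_eval_add: "complex_eval (p + q) z = complex_eval p z + complex_eval q z"
proof -
  have "map_poly complex_of_real (p + q) = map_poly complex_of_real p + map_poly complex_of_real q"
    by (rule poly_eqI) (simp add: coeff_map_poly)
  then show ?thesis by (simp add: complex_eval_def)
qed

lemma complex_eval_smult: "complex_eval (smult c p) z = complex_of_real c * complex_eval p z"
  by (induction p) (simp_all add: complex_eval_0 complex_eval_pCons algebra_simps)

lemma complex_eval_diff: "complex_eval (p - q) z = complex_eval p z - complex_eval q z"
  using complex_eval_add [of "p - q" q z] by simp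

lemma complex_eval_mult: "complex_eval (p * q) z = complex_eval p z * complex_eval q z"
  by (induction p)
    (simp_all add: complex_eval_0 complex_eval_pCons complex_eval_add complex_eval_smult algebra_simps)

lemma complex_eval_1: "complex_eval 1 z = 1"
  by (simp add: one_pCons complex_eval_pCons complex_eval_0)

lemma complex_eval_numeral: "complex_eval (numeral m) z = numeral m"
  by (simp add: numeral_poly complex_eval_pCons complex_eval_0)

lemmas complex_eval_simps = complex_eval_numeral complex_eval_0 complex_eval_1 complex_eval_pCons complex_eval_add
  complex_eval_diff complex_eval_smult complex_eval_mult

lemma complex_eval_has_field_derivative:
  "(complex_eval p has_field_derivative complex_eval (pderiv p) z) (at z)"
proof (induction p)
  case 0
  then show ?case by (simp add: complex_eval_def [abs_def])
next
  case (pCons a p)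
  then show ?case
    unfolding complex_eval_pCons [abs_def]
    by (auto intro!: derivative_eq_intros simp: pderiv_pCons complex_eval_simps)
qed

lemma deriv_complex_eval: "deriv (complex_eval p) = complex_eval (pderiv p)"
  using complex_eval_has_field_derivative by (intro ext DERIV_imp_deriv)

section \<open>The Pearson equation and the ladder relations\<close>

locale pearson_orthogonal_family = even_orthogonal_family +
  fixes \<alpha> t :: real
  assumes pearson:
    "L ((1 - X * X) * pderiv q) = L (smult (2 * (\<alpha> + 1)) (X * q) + smult (2 * t) (X * (1 - X * X) * q))"
begin

abbreviation \<beta> :: "nat \<Rightarrow> real" where "\<beta> \<equiv> rec_coeff h"

abbreviation R :: "nat \<Rightarrow> real" where "R \<equiv> ladder_num \<alpha> t \<beta>"

abbreviation r :: "nat \<Rightarrow> real" where "r n \<equiv> real n - 2 * t * \<beta> n"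

lemma R_eq_r_sum: "R n = r (Suc n) + r n + 2 * \<alpha>"
  by (simp add: ladder_num_def algebra_simps)

text \<open>\<open>K n\<close> is \<open>\<beta>\<^sub>n P\<^sub>n\<^sub>-\<^sub>1\<close>, written by means of the recurrence in a form that
  also makes sense, and is \<open>0\<close>, for \<open>n = 0\<close>. So the ladder relations hold for all \<open>n\<close> uniformly.\<close>

definition K :: "nat \<Rightarrow> real poly" where
  "K n = X * P n - P (Suc n)"

lemma K_0: "K 0 = 0"
  by (simp add: K_def P_0 P_1)

lemma K_Suc: "K (Suc n) = smult (\<beta> (Suc n)) (P n)"
  unfolding K_def three_term_recurrence by simp

text \<open>The constants \<open>r\<^sub>n\<close> and \<open>R\<^sub>n\<close> are what makes the difference \<open>Q\<close> of the two sides vanish: \<open>r\<^sub>n\<close> cancels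
  the coefficient of \<open>x\<^sup>n\<^sup>+\<^sup>1\<close>, and \<open>R\<^sub>n\<close> makes \<open>Q\<close> orthogonal to \<open>P\<^sub>n\<^sub>-\<^sub>1\<close>. To test \<open>Q\<close> against \<open>q\<close> of degree
  below \<open>n\<close>, the Pearson equation for \<open>P\<^sub>n q\<close> moves the derivative from \<open>P\<^sub>n\<close> to \<open>q\<close>. The terms of too high
  degree, \<open>x\<^sup>3 P\<^sub>n q\<close> and \<open>\<beta>\<^sub>n x\<^sup>2 P\<^sub>n\<^sub>-\<^sub>1 q\<close>, combine by the recurrence to \<open>x\<^sup>2 P\<^sub>n\<^sub>+\<^sub>1 q\<close>. What remains pairs
  each \<open>P\<^sub>k\<close> with a polynomial of degree at most \<open>k\<close>, so only the coefficient of \<open>x\<^sup>n\<^sup>-\<^sup>1\<close> in \<open>q\<close>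
  contributes.\<close>

lemma lowering_relation:
  "(1 - X * X) * pderiv (P n) = (smult (2 * t) (1 - X * X) + [:R n:]) * K n - smult (r n) (X * P n)"
proof (cases n)
  case 0
  then show ?thesis by (simp add: K_0 P_0)
next
  case (Suc m)
  define Q where "Q = (1 - X * X) * pderiv (P n)
    - smult (2 * t * \<beta> n) ((1 - X * X) * P m) - smult (\<beta> n * R n) (P m) + smult (r n) (X * P n)"
  have "Q = 0"
  proof (rule eq_0_if_orthogonal_to_low [where n = n])
    fix i assume i: "i \<ge> n"
    have Q_coeff: "coeff Q i = real (Suc i) * coeff (P n) (Suc i)
        - real (i - 1) * coeff (P n) (i - 1)
        - \<beta> n * (2 * t * (coeff (P m) i - (if i < 2 then 0 else coeff (P m) (i - 2)))
             + R n * coeff (P m) i)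
        + r n * coeff (P n) (i - 1)"
    proof -
      obtain j where j: "i = Suc j" using i Suc by (cases i) auto
      show ?thesis
        by (cases j)
          (simp_all add: Q_def j coeff_one_minus_X_square_mult coeff_X_mult coeff_pderiv
            distrib_left right_diff_distrib del: mult_pCons_left mult_pCons_right)
    qed
    consider "i = n" | "i = Suc n" | "i > Suc n" using i by linarith
    then show "coeff Q i = 0"
    proof cases
      case 1
      have sub: "(if i < 2 then 0 else coeff (P m) (i - 2)) = 0"
        using 1 Suc coeff_P_subleading [of "i - 2"]
        by (auto simp: Suc_diff_Suc numeral_2_eq_2)
      show ?thesis unfolding Q_coeff sub using 1 Suc
        by (simp add: coeff_P_high coeff_P_subleading)
    next
      case 2
      then show ?thesis unfolding Q_coeff using Suc
        by (simp add: coeff_P_high algebra_simps)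
    next
      case 3
      then show ?thesis unfolding Q_coeff using Suc
        by (simp add: coeff_P_high)
    qed
  next
    fix q :: "real poly" assume q: "\<And>i. i \<ge> n \<Longrightarrow> coeff q i = 0"
    define c where "c = coeff q m"
    have 1: "L (P n * (X * q)) = c * h n"
      using L_P_mult [of n "X * q"] q
      by (simp add: coeff_X_mult Suc c_def del: mult_pCons_left)
    have 2: "L (P (Suc n) * (X * (X * q))) = c * h (Suc n)"
      using L_P_mult [of "Suc n" "X * (X * q)"] q
      by (simp add: coeff_X_mult Suc c_def del: mult_pCons_left)
    have 3: "L (P m * q) = c * h m"
      using L_P_mult [of m q] q by (simp add: Suc c_def)
    have 4: "L (P n * ((1 - X * X) * pderiv q)) = - real m * c * h n"
    proof -
      have *: "coeff ((1 - X * X) * pderiv q) i = - real m * (if i = n then c else 0)"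
        if i: "i \<ge> n" for i
      proof -
        obtain j where j: "i = Suc j" using i Suc by (cases i) auto
        show ?thesis using i q [of "Suc i"] q [of "j"]
          by (cases j; cases "i = n")
            (simp_all add: j Suc coeff_one_minus_X_square_mult coeff_pderiv c_def
              del: mult_pCons_left mult_pCons_right)
      qed
      show ?thesis
        using L_P_mult [of n "(1 - X * X) * pderiv q"] * by simp
    qed
    have 5: "P n * (X * (X * (X * q))) = P (Suc n) * (X * (X * q)) + smult (\<beta> n) (P m * (X * (X * q)))"
    proof -
      have "P n * (X * (X * (X * q))) = (X * P n) * (X * (X * q))"
        by (simp only: ac_simps)
      also have "\<dots> = (P (Suc n) + smult (\<beta> n) (P m)) * (X * (X * q))"
        using three_term_recurrence [of m] by (simp only: Suc)
      finally show ?thesis by (simp only: distrib_right mult_smult_left)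
    qed
    have "Q * q = (1 - X * X) * pderiv (P n * q) - P n * ((1 - X * X) * pderiv q)
        - smult (\<beta> n * (2 * t + R n)) (P m * q) + smult (2 * t * \<beta> n) (P m * (X * (X * q)))
        + smult (r n) (P n * (X * q))"
      by (rule poly_ext) (simp add: Q_def pderiv_mult algebra_simps)
    moreover have "smult (2 * (\<alpha> + 1)) (X * (P n * q)) + smult (2 * t) (X * (1 - X * X) * (P n * q))
       = smult (2 * (\<alpha> + 1) + 2 * t) (P n * (X * q)) - smult (2 * t) (P n * (X * (X * (X * q))))"
      by (rule poly_ext) (simp add: algebra_simps)
    ultimately have "L (Q * q) = (2 * (\<alpha> + 1) + 2 * t) * (c * h n) - 2 * t * (c * h (Suc n))
        + real m * c * h n - \<beta> n * (2 * t + R n) * (c * h m) + r n * (c * h n)"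
      by (simp only: pearson L_add L_diff L_smult 1 2 3 4 5) (simp add: algebra_simps)
    also have "\<dots> = c * ((2 * (\<alpha> + 1) + 2 * t + real m + r n) * h n - 2 * t * h (Suc n)
        - (2 * t + R n) * (\<beta> n * h m))"
      by (simp add: algebra_simps)
    also have "\<beta> n * h m = h n" using rec_coeff_Suc_h [of m] by (simp add: Suc)
    also have "h (Suc n) = \<beta> (Suc n) * h n" using rec_coeff_Suc_h [of n] by simp
    also have "c * ((2 * (\<alpha> + 1) + 2 * t + real m + r n) * h n - 2 * t * (\<beta> (Suc n) * h n)
        - (2 * t + R n) * h n) = 0"
      by (simp add: ladder_num_def Suc algebra_simps)
    finally show "L (Q * q) = 0" .
  qed
  then have "poly Q x = 0" for x by simp
  then show ?thesis
    by (intro poly_ext) (simp add: Q_def Suc K_Suc algebra_simps)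
qed

text \<open>The lowering relation at \<open>n - 1\<close>, with \<open>\<beta>\<^sub>n\<^sub>-\<^sub>1 P\<^sub>n\<^sub>-\<^sub>2\<close> replaced by \<open>x P\<^sub>n\<^sub>-\<^sub>1 - P\<^sub>n\<close>. At \<open>n = 0\<close> the truncated
  index in \<open>R (n - 1)\<close> is harmless because it is multiplied by \<open>\<beta>\<^sub>0 = 0\<close>.\<close>

lemma raising_relation:
  "(1 - X * X) * pderiv (K n)
    = (smult (2 * t) (X * (1 - X * X)) + smult (2 * \<alpha> + r n) X) * K n
      - smult (\<beta> n) ((smult (2 * t) (1 - X * X) + [:R (n - 1):]) * P n)"
proof (cases n)
  case 0
  then show ?thesis by (simp add: K_0)
next
  case (Suc m)
  have K_m: "K m = X * P m - P n" by (simp add: K_def Suc)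
  have "(1 - X * X) * pderiv (P m)
      = (smult (2 * t) (X * (1 - X * X)) + smult (2 * \<alpha> + r n) X) * P m
        - (smult (2 * t) (1 - X * X) + [:R m:]) * P n"
    unfolding lowering_relation K_m R_eq_r_sum Suc
    by (rule poly_ext) (simp, algebra)
  then have "smult (\<beta> n) ((1 - X * X) * pderiv (P m))
      = smult (\<beta> n) ((smult (2 * t) (X * (1 - X * X)) + smult (2 * \<alpha> + r n) X) * P m
        - (smult (2 * t) (1 - X * X) + [:R m:]) * P n)"
    by (simp only:)
  then show ?thesis
    unfolding Suc K_Suc pderiv_smult mult_smult_right smult_diff_right by simp
qed

text \<open>Differentiating \<open>P\<^sub>n\<^sub>+\<^sub>1 = x P\<^sub>n - K\<^sub>n\<close> and multiplying by \<open>1 - x\<^sup>2\<close>, the ladder relations express both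
  sides through \<open>P\<^sub>n\<close> and \<open>K\<^sub>n\<close>. The \<open>K\<^sub>n\<close> terms cancel because \<open>R\<^sub>n = r\<^sub>n\<^sub>+\<^sub>1 + r\<^sub>n + 2 \<alpha>\<close>, and what is left is
  a quadratic polynomial \<open>k\<^sub>0 + k\<^sub>2 x\<^sup>2\<close> times \<open>P\<^sub>n\<close>. So this quadratic vanishes, and \<open>k\<^sub>0 + k\<^sub>2 = 0\<close> is the
  claim.\<close>

lemma compatibility:
  "r (Suc n) - r n = \<beta> (Suc n) * R (Suc n) - \<beta> n * R (n - 1)"
proof -
  let ?k0 = "1 - \<beta> (Suc n) * (2 * t + R (Suc n)) + \<beta> n * (2 * t + R (n - 1))"
  let ?k2 = "r (Suc n) - r n - 1 + 2 * t * \<beta> (Suc n) - 2 * t * \<beta> n"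
  have "[:?k0, 0, ?k2:] * P n = 0"
  proof (rule poly_ext)
    fix x
    have "P (Suc n) = X * P n - K n" by (simp add: K_def)
    then have p: "poly (P (Suc n)) x = x * poly (P n) x - poly (K n) x"
      and p': "poly (pderiv (P (Suc n))) x
        = poly (P n) x + x * poly (pderiv (P n)) x - poly (pderiv (K n)) x"
      by (simp_all add: pderiv_diff pderiv_mult pderiv_pCons)
    have k: "poly (K (Suc n)) x = \<beta> (Suc n) * poly (P n) x"
      by (simp add: K_Suc)
    have l: "(1 - x * x) * poly (pderiv (P n)) x
        = (2 * t * (1 - x * x) + R n) * poly (K n) x - r n * x * poly (P n) x" for n
      using arg_cong [OF lowering_relation [of n], of "\<lambda>p. poly p x"] by (simp add: algebra_simps)
    have u: "(1 - x * x) * poly (pderiv (K n)) x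
        = (2 * t * (1 - x * x) + 2 * \<alpha> + r n) * x * poly (K n) x
          - \<beta> n * (2 * t * (1 - x * x) + R (n - 1)) * poly (P n) x"
      using arg_cong [OF raising_relation [of n], of "\<lambda>p. poly p x"] by (simp add: algebra_simps)
    have "(1 - x * x) * (poly (P n) x + x * poly (pderiv (P n)) x - poly (pderiv (K n)) x)
       = (2 * t * (1 - x * x) + R (Suc n)) * (\<beta> (Suc n) * poly (P n) x)
         - r (Suc n) * x * (x * poly (P n) x - poly (K n) x)"
      using l [of "Suc n"] by (simp only: p p' k)
    then have "(?k0 + x * (x * ?k2)) * poly (P n) x = 0"
      using l [of n] u R_eq_r_sum [of n] by algebra
    then show "poly ([:?k0, 0, ?k2:] * P n) x = poly 0 x"
      by (simp only: poly_mult poly_pCons poly_0) (simp add: algebra_simps)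
  qed
  then have "[:?k0, 0, ?k2:] = 0" by (metis P_nonzero mult_eq_0_iff)
  then show ?thesis by (simp add: algebra_simps)
qed

text \<open>Multiplying \<open>compatibility\<close> by \<open>R\<^sub>n\<close> turns its left-hand side into the difference of
  \<open>r\<^sub>n (r\<^sub>n + 2 \<alpha>)\<close> and its right-hand side into the difference of \<open>\<beta>\<^sub>n R\<^sub>n R\<^sub>n\<^sub>-\<^sub>1\<close>. Both sequences start
  at \<open>0\<close>.\<close>

lemma R_product: "\<beta> n * R n * R (n - 1) = r n * (r n + 2 * \<alpha>)"
proof (induction n)
  case (Suc n)
  have "\<beta> (Suc n) * R (Suc n) * R n = (r (Suc n) - r n) * R n + \<beta> n * R n * R (n - 1)"
    using compatibility [of n] by algebra
  also have "\<dots> = r (Suc n) * (r (Suc n) + 2 * \<alpha>)"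
    using Suc.IH R_eq_r_sum [of n] by algebra
  finally show ?case by simp
qed simp

text \<open>With \<open>D = r\<^sub>n\<^sub>+\<^sub>1 - r\<^sub>n = 1 - 2 t (\<beta>\<^sub>n\<^sub>+\<^sub>1 - \<beta>\<^sub>n)\<close>, the right-hand side grows in one step by
  \<open>D (R\<^sub>n - 2 t) + 2 t (D + (\<beta>\<^sub>n\<^sub>+\<^sub>1 - \<beta>\<^sub>n) R\<^sub>n) = D R\<^sub>n + (1 - D) R\<^sub>n = R\<^sub>n\<close>, where \<open>compatibility\<close> enters
  through the second summand.\<close>

lemma R_sum:
  "(\<Sum>j<n. R j) = r n * (r n + 2 * \<alpha> - 2 * t) + 2 * t * \<beta> n * (R n + R (n - 1))"
proof (induction n)
  case (Suc n)
  have "r (Suc n) - r n = 1 - 2 * t * (\<beta> (Suc n) - \<beta> n)"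
    by (simp add: algebra_simps)
  then have "r n * (r n + 2 * \<alpha> - 2 * t) + 2 * t * \<beta> n * (R n + R (n - 1)) + R n
    = r (Suc n) * (r (Suc n) + 2 * \<alpha> - 2 * t) + 2 * t * \<beta> (Suc n) * (R (Suc n) + R n)"
    using compatibility [of n] R_eq_r_sum [of n] by algebra
  then show ?case using Suc.IH by simp
qed simp

lemma sum_ladder_A:
  "(\<Sum>j<n. ladder_A \<alpha> t \<beta> j z)
    = complex_of_real (2 * real n * t) + complex_of_real (\<Sum>j<n. R j) / (1 - z\<^sup>2)"
  by (simp add: ladder_A_def sum.distrib sum_divide_distrib)

text \<open>By \<open>R_product\<close> the last fraction is \<open>2 t \<beta>\<^sub>n R\<^sub>n\<^sub>-\<^sub>1 / (1 - z\<^sup>2)\<close>, which is the part of \<open>R_sum\<close> that involves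
  \<open>R\<^sub>n\<^sub>-\<^sub>1\<close>.\<close>

lemma sum_ladder_A_closed_form:
  assumes "R n \<noteq> 0"
  shows "(\<Sum>j<n. ladder_A \<alpha> t \<beta> j z) =
      complex_of_real (2 * real n * t)
      + complex_of_real ((real n)\<^sup>2 - 2 * real n * (t - \<alpha>)
          + 2 * t * \<beta> n * (2 * t + 1 - 2 * t * \<beta> (n + 1))) / (1 - z\<^sup>2)
      + complex_of_real (2 * t * r n * (real n + 2 * \<alpha> - 2 * t * \<beta> n))
          / (complex_of_real (R n) * (1 - z\<^sup>2))"
proof -
  have "2 * t * r n * (real n + 2 * \<alpha> - 2 * t * \<beta> n) = 2 * t * (r n * (r n + 2 * \<alpha>))"
    by (simp add: algebra_simps)
  also have "\<dots> = 2 * t * \<beta> n * R (n - 1) * R n"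
    unfolding R_product [symmetric] by (simp add: algebra_simps)
  finally have numerator: "2 * t * r n * (real n + 2 * \<alpha> - 2 * t * \<beta> n)
      = 2 * t * \<beta> n * R (n - 1) * R n" .
  have "complex_of_real (2 * t * r n * (real n + 2 * \<alpha> - 2 * t * \<beta> n))
      / (complex_of_real (R n) * (1 - z\<^sup>2))
    = complex_of_real (2 * t * \<beta> n * R (n - 1)) / (1 - z\<^sup>2)"
    unfolding numerator using assms by simp
  moreover have "(\<Sum>j<n. R j) = (real n)\<^sup>2 - 2 * real n * (t - \<alpha>)
      + 2 * t * \<beta> n * (2 * t + 1 - 2 * t * \<beta> (n + 1)) + 2 * t * \<beta> n * R (n - 1)"
    unfolding R_sum by (simp add: ladder_num_def power2_eq_square algebra_simps)
  ultimately show ?thesis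
    unfolding sum_ladder_A by (simp add: add_divide_distrib)
qed

text \<open>With \<open>u = 1 - z\<^sup>2\<close> and \<open>a = u A\<^sub>n\<close>, the equation is a polynomial identity modulo the lowering relation
  \<open>E1\<close>, its derivative \<open>E1'\<close>, the raising relation \<open>E2\<close> and
  \<open>\<beta>\<^sub>n A\<^sub>n A\<^sub>n\<^sub>-\<^sub>1 = \<Sum>\<^sub>j\<^sub><\<^sub>n A\<^sub>j + B\<^sub>n\<^sup>2 + v' B\<^sub>n\<close>, which is \<open>S2\<close> below after multiplication by \<open>u\<^sup>2\<close>. As
  \<open>E1\<close> determines \<open>a K\<^sub>n\<close> rather than \<open>K\<^sub>n\<close>, one more factor \<open>a\<close> is needed to eliminate it.\<close>

lemma differential_equation:
  assumes z: "z \<noteq> 1" "z \<noteq> -1" and A: "ladder_A \<alpha> t \<beta> n z \<noteq> 0"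
  shows "(deriv ^^ 2) (complex_eval (P n)) z
    - (potential_deriv \<alpha> t z + deriv (ladder_A \<alpha> t \<beta> n) z / ladder_A \<alpha> t \<beta> n z)
        * deriv (complex_eval (P n)) z
    + (deriv (ladder_B t \<beta> n) z
        - ladder_B t \<beta> n z * (deriv (ladder_A \<alpha> t \<beta> n) z / ladder_A \<alpha> t \<beta> n z)
        + (\<Sum>j<n. ladder_A \<alpha> t \<beta> j z)) * complex_eval (P n) z = 0"
proof -
  define u where "u = 1 - z\<^sup>2"
  have u: "u \<noteq> 0" using z by (auto simp: u_def power2_eq_1_iff)
  define y y1 y2 k k1 where "y = complex_eval (P n) z"
    and "y1 = complex_eval (pderiv (P n)) z" and "y2 = complex_eval (pderiv (pderiv (P n))) z"
    and "k = complex_eval (K n) z" and "k1 = complex_eval (pderiv (K n)) z"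
  define rn b R1 R0 T al S N where
    "rn = complex_of_real (r n)" and "b = complex_of_real (\<beta> n)" and "R1 = complex_of_real (R n)"
    and "R0 = complex_of_real (R (n - 1))" and "T = complex_of_real t" and "al = complex_of_real \<alpha>"
    and "S = complex_of_real (\<Sum>j<n. R j)" and "N = complex_of_real (real n)"
  note coeff_defs = rn_def b_def R1_def R0_def T_def al_def S_def N_def
  define a where "a = 2 * T * u + R1"
  have E1: "u * y1 = a * k - rn * (z * y)"
    using arg_cong [OF lowering_relation [of n], of "\<lambda>p. complex_eval p z"]
    by (simp add: complex_eval_simps u_def y_def y1_def k_def a_def coeff_defs power2_eq_square
        del: mult_pCons_left of_real_diff)
  have E1': "u * y2 - 2 * z * y1 = a * k1 - 4 * T * z * k - rn * y - rn * z * y1"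
    using arg_cong [OF lowering_relation [of n], of "\<lambda>p. complex_eval (pderiv p) z"]
    by (simp add: complex_eval_simps u_def y_def y1_def y2_def k_def k1_def a_def coeff_defs
        power2_eq_square pderiv_mult pderiv_diff pderiv_add pderiv_smult pderiv_pCons
        del: mult_pCons_left mult_pCons_right of_real_diff)
      (simp add: algebra_simps)
  have E2: "u * k1 = (2 * T * (z * u) + (2 * al + rn) * z) * k - b * ((2 * T * u + R0) * y)"
    using arg_cong [OF raising_relation [of n], of "\<lambda>p. complex_eval p z"]
    by (simp add: complex_eval_simps u_def y_def k_def k1_def coeff_defs power2_eq_square
        del: mult_pCons_left of_real_diff)
  have C0: "b * R1 * R0 = rn * (rn + 2 * al)"
    using arg_cong [OF R_product [of n], of complex_of_real] by (simp add: coeff_defs)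
  have C1: "S = rn * (rn + 2 * al - 2 * T) + 2 * T * b * (R1 + R0)"
    using arg_cong [OF R_sum [of n], of complex_of_real] by (simp add: coeff_defs)
  have C2: "rn = N - 2 * T * b" by (simp add: coeff_defs)
  have z2: "z * z = 1 - u" by (simp add: u_def power2_eq_square)
  have A': "ladder_A \<alpha> t \<beta> n z = a / u"
    using u by (simp add: ladder_A_def a_def coeff_defs u_def field_simps)
  have a: "a \<noteq> 0" using A A' by auto
  have dA: "deriv (ladder_A \<alpha> t \<beta> n) z = 2 * z * R1 / u\<^sup>2"
    unfolding ladder_A_def [abs_def]
    by (rule DERIV_imp_deriv) (use u in \<open>auto intro!: derivative_eq_intros
        simp: coeff_defs u_def power2_eq_square\<close>)
  have dB: "deriv (ladder_B t \<beta> n) z = rn * (1 + z * z) / u\<^sup>2"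
    unfolding ladder_B_def [abs_def]
    by (rule DERIV_imp_deriv) (use u in \<open>auto intro!: derivative_eq_intros
        simp: coeff_defs u_def power2_eq_square algebra_simps\<close>)
  have B: "ladder_B t \<beta> n z = z * rn / u"
    by (simp add: ladder_B_def coeff_defs u_def)
  have sA: "(\<Sum>j<n. ladder_A \<alpha> t \<beta> j z) = 2 * N * T + S / u"
    unfolding sum_ladder_A by (simp add: coeff_defs u_def)
  have v: "potential_deriv \<alpha> t z = 2 * T * z + 2 * al * z / u"
    by (simp add: potential_deriv_def coeff_defs u_def)
  have S2: "b * a * (2 * T * u + R0)
      = u * u * (2 * N * T) + u * S + z * z * rn * rn + (2 * T * u + 2 * al) * (z * z) * rn"
    unfolding a_def z2 using C0 C1 C2 by algebra
  \<comment> \<open>The differential equation multiplied by \<open>u\<^sup>2 a\<close>.\<close>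
  have main: "u * u * a * y2 - u * (a * z * (2 * T * u + 2 * al) + 2 * z * R1) * y1
      + (rn * (1 + z * z) * a - 2 * z * z * rn * R1 + a * (u * u * (2 * N * T) + u * S)) * y = 0"
    using E1 E1' E2 S2 a_def z2 by algebra
  have "y2 - (2 * T * z + 2 * al * z / u + 2 * z * R1 / u\<^sup>2 / (a / u)) * y1
      + (rn * (1 + z * z) / u\<^sup>2 - z * rn / u * (2 * z * R1 / u\<^sup>2 / (a / u))
         + (2 * N * T + S / u)) * y
    = (u * u * a * y2 - u * (a * z * (2 * T * u + 2 * al) + 2 * z * R1) * y1
      + (rn * (1 + z * z) * a - 2 * z * z * rn * R1 + a * (u * u * (2 * N * T) + u * S)) * y)
      / (u * u * a)"
    using u a by (simp add: field_simps power2_eq_square)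
  also have "\<dots> = 0" unfolding main by simp
  finally show ?thesis
    unfolding A' dA dB B sA v by (simp add: deriv_complex_eval y_def y1_def y2_def numeral_2_eq_2)
qed

end

section \<open>The weighted integral\<close>

definition weighted_integral :: "real \<Rightarrow> real \<Rightarrow> real poly \<Rightarrow> real" where
  "weighted_integral \<alpha> t p = integral {-1..1} (\<lambda>x. poly p x * weight \<alpha> t x)"

text \<open>The fundamental theorem of calculus for \<open>(1 - x\<^sup>2) w q\<close>. Writing this function with the exponent
  \<open>\<alpha> + 1 > 0\<close> makes it continuous on the closed interval and zero at the endpoints, even where the
  weight itself is unbounded. Integrability of the derivative comes for free.\<close>

lemma weight_pearson:
  assumes "\<alpha> > -1"
  shows "((\<lambda>x. ((1 - x\<^sup>2) * poly (pderiv q) x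
      - (2 * (\<alpha> + 1) * x + 2 * t * (x * (1 - x\<^sup>2))) * poly q x) * weight \<alpha> t x)
    has_integral 0) {-1..1}"
proof -
  define F where "F x = (1 - x\<^sup>2) powr (\<alpha> + 1) * exp (- t * x\<^sup>2) * poly q x" for x
  have "continuous_on {-1..1} F"
    unfolding F_def using assms
    by (intro continuous_intros continuous_on_powr') (auto simp: abs_square_le_1)
  moreover have "(F has_vector_derivative ((1 - x\<^sup>2) * poly (pderiv q) x
      - (2 * (\<alpha> + 1) * x + 2 * t * (x * (1 - x\<^sup>2))) * poly q x) * weight \<alpha> t x) (at x)"
    if "x \<in> {-1<..<1}" for x
  proof -
    have x: "1 - x\<^sup>2 > 0" using that by (simp add: abs_square_less_1 abs_less_iff)
    have "(F has_field_derivative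
        ((\<alpha> + 1) * (1 - x\<^sup>2) powr \<alpha> * (- 2 * x)) * exp (- t * x\<^sup>2) * poly q x
        + (1 - x\<^sup>2) powr (\<alpha> + 1) * (exp (- t * x\<^sup>2) * (- 2 * t * x)) * poly q x
        + (1 - x\<^sup>2) powr (\<alpha> + 1) * exp (- t * x\<^sup>2) * poly (pderiv q) x) (at x)"
      unfolding F_def using x
      by (auto intro!: derivative_eq_intros simp: algebra_simps)
    also have "(1 - x\<^sup>2) powr (\<alpha> + 1) = (1 - x\<^sup>2) * (1 - x\<^sup>2) powr \<alpha>"
      using x by (simp add: powr_add)
    finally show ?thesis
      unfolding has_real_derivative_iff_has_vector_derivative weight_def
      by (rule back_subst) (simp add: algebra_simps)
  qed
  ultimately have "((\<lambda>x. ((1 - x\<^sup>2) * poly (pderiv q) x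
      - (2 * (\<alpha> + 1) * x + 2 * t * (x * (1 - x\<^sup>2))) * poly q x) * weight \<alpha> t x)
    has_integral (F 1 - F (-1))) {-1..1}"
    by (intro fundamental_theorem_of_calculus_interior) auto
  then show ?thesis by (simp add: F_def)
qed

text \<open>The weight may be unbounded at \<open>\<plusminus>1\<close>, so the argument takes place on \<open>[-1/2, 1/2]\<close>, where it is
  continuous and positive: a polynomial that vanishes there has infinitely many roots.\<close>

lemma weighted_square_integral_pos:
  assumes "p \<noteq> 0" and int: "(\<lambda>x. poly (p * p) x * weight \<alpha> t x) integrable_on {-1..1}"
  shows "integral {-1..1} (\<lambda>x. poly (p * p) x * weight \<alpha> t x) > 0"
proof -
  let ?f = "\<lambda>x. poly (p * p) x * weight \<alpha> t x"
  have nonneg: "?f x \<ge> 0" for x by (simp add: weight_def)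
  have pos: "weight \<alpha> t x > 0" if "x \<in> {-1/2..1/2}" for x
  proof -
    have "x\<^sup>2 < 1" using that by (simp add: abs_square_less_1 abs_less_iff)
    then show ?thesis by (simp add: weight_def)
  qed
  have cont: "continuous_on {-1/2..1/2} ?f"
    unfolding weight_def
  proof (intro continuous_intros ballI)
    fix x :: real assume "x \<in> {-1/2..1/2}"
    then have "x\<^sup>2 < 1" by (simp add: abs_square_less_1 abs_less_iff)
    then show "1 - x\<^sup>2 \<noteq> 0" by simp
  qed
  have "integral {-1/2..1/2} ?f \<noteq> 0"
  proof
    assume "integral {-1/2..1/2} ?f = 0"
    then have "\<forall>x\<in>{-1/2..1/2}. ?f x = 0"
      using integral_eq_0_iff [OF cont] nonneg by simp
    then have "{-1/2..1/2} \<subseteq> {x. poly p x = 0}" using pos by force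
    then have "finite {-1/2..1/2 :: real}"
      using poly_roots_finite [OF \<open>p \<noteq> 0\<close>] finite_subset by blast
    then show False using infinite_Icc [of "-1/2" "1/2 :: real"] by simp
  qed
  moreover have "integral {-1/2..1/2} ?f \<ge> 0"
    using nonneg by (intro integral_nonneg integrable_continuous_real cont) 
  moreover have "integral {-1/2..1/2} ?f \<le> integral {-1..1} ?f"
    using nonneg by (intro integral_subset_le integrable_continuous_real [OF cont] int) auto
  ultimately show ?thesis by linarith
qed

lemma pearson_orthogonal_family_weighted_integral:
  assumes "\<alpha> > -1" and orth: "monic_orthogonal_polys \<alpha> t P h"
  shows "pearson_orthogonal_family (weighted_integral \<alpha> t) P h \<alpha> t"
proof -
  have deg: "degree (P n) = n" and monic: "lead_coeff (P n) = 1" for n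
    using orth unfolding monic_orthogonal_polys_def by blast+
  have prod: "((\<lambda>x. poly (P m * P n) x * weight \<alpha> t x)
      has_integral (if m = n then h n else 0)) {-1..1}" for m n
    using orth unfolding monic_orthogonal_polys_def poly_mult by blast
  have P0: "P 0 = 1"
    using deg [of 0] monic [of 0] by (auto elim!: degree_eq_zeroE simp: one_pCons)
  \<comment> \<open>Taking \<open>m = 0\<close> in the orthogonality relations shows that each \<open>P\<^sub>k\<close> is integrable against the
    weight, and the \<open>P\<^sub>k\<close> span all polynomials.\<close>
  have int: "(\<lambda>x. poly p x * weight \<alpha> t x) integrable_on {-1..1}" for p
  proof (rule monic_basis_induct [where S = "\<lambda>p. (\<lambda>x. poly p x * weight \<alpha> t x) integrable_on {-1..1}"
        and P = P and m = "Suc (degree p)", OF deg monic])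
    fix k c q assume "(\<lambda>x. poly q x * weight \<alpha> t x) integrable_on {-1..1}"
    moreover have "(\<lambda>x. poly (P k) x * weight \<alpha> t x) integrable_on {-1..1}"
      using prod [of 0 k] P0 by (auto simp: integrable_on_def)
    ultimately have "(\<lambda>x. c * (poly (P k) x * weight \<alpha> t x) + poly q x * weight \<alpha> t x)
        integrable_on {-1..1}"
      by (intro integrable_add integrable_on_mult_right)
    then show "(\<lambda>x. poly (smult c (P k) + q) x * weight \<alpha> t x) integrable_on {-1..1}"
      by (simp add: algebra_simps)
  qed (auto simp: coeff_eq_0)
  show ?thesis
  proof
    show "weighted_integral \<alpha> t (p + q) = weighted_integral \<alpha> t p + weighted_integral \<alpha> t q" for p q
      using integral_add [OF int int] by (simp add: weighted_integral_def distrib_right)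
    show "weighted_integral \<alpha> t (smult c p) = c * weighted_integral \<alpha> t p" for c p
      by (simp add: weighted_integral_def mult.assoc)
    show "weighted_integral \<alpha> t (p * p) > 0" if "p \<noteq> 0" for p
      using weighted_square_integral_pos [OF that int] by (simp add: weighted_integral_def)
    show "weighted_integral \<alpha> t (P m * P n) = (if m = n then h n else 0)" for m n
      unfolding weighted_integral_def using prod by (rule integral_unique)
    show "weighted_integral \<alpha> t (pcompose p [:0, -1:]) = weighted_integral \<alpha> t p" for p
      using Henstock_Kurzweil_Integration.integral_reflect_real [of 1 "-1" "\<lambda>x. poly p x * weight \<alpha> t x"]
      by (simp add: weighted_integral_def poly_pcompose weight_def)
    fix q
    let ?V = "smult (2 * (\<alpha> + 1)) (X * q) + smult (2 * t) (X * (1 - X * X) * q)"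
    have "((\<lambda>x. poly ((1 - X * X) * pderiv q - ?V) x * weight \<alpha> t x) has_integral 0) {-1..1}"
      using weight_pearson [OF \<open>\<alpha> > -1\<close>, of q t]
      by (rule has_integral_eq_rhs [OF has_integral_eq, rotated]) (simp_all add: algebra_simps power2_eq_square)
    then have "0 = integral {-1..1} (\<lambda>x. poly ((1 - X * X) * pderiv q) x * weight \<alpha> t x
         - poly ?V x * weight \<alpha> t x)"
      by (simp only: integral_unique poly_diff left_diff_distrib)
    also have "\<dots> = weighted_integral \<alpha> t ((1 - X * X) * pderiv q) - weighted_integral \<alpha> t ?V"
      unfolding weighted_integral_def by (rule integral_diff [OF int int])
    finally show "weighted_integral \<alpha> t ((1 - X * X) * pderiv q) = weighted_integral \<alpha> t ?V"
      by simp
  qed (use deg monic in auto)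
qed

lemma has_vector_derivative_potential:
  assumes "x \<in> {-1<..<1}"
  shows "((\<lambda>x. complex_of_real (potential \<alpha> t x)) has_vector_derivative
    potential_deriv \<alpha> t (complex_of_real x)) (at x)"
proof -
  have pos: "1 - y\<^sup>2 > 0" if "y \<in> {-1<..<1}" for y :: real
    using that by (simp add: abs_square_less_1 abs_less_iff)
  have "((\<lambda>x. t * x\<^sup>2 - \<alpha> * ln (1 - x\<^sup>2)) has_field_derivative
      2 * t * x + 2 * \<alpha> * x / (1 - x\<^sup>2)) (at x)"
    using pos [OF assms] by (auto intro!: derivative_eq_intros)
  then have "(potential \<alpha> t has_field_derivative 2 * t * x + 2 * \<alpha> * x / (1 - x\<^sup>2)) (at x)"
  proof (rule has_field_derivative_transform_within_open [where S = "{-1<..<1}"])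
    show "t * y\<^sup>2 - \<alpha> * ln (1 - y\<^sup>2) = potential \<alpha> t y" if "y \<in> {-1<..<1}" for y
      using pos [OF that] by (simp add: potential_def weight_def ln_mult ln_powr)
  qed (use assms in auto)
  then have "((\<lambda>x. complex_of_real (potential \<alpha> t x)) has_vector_derivative
      complex_of_real (2 * t * x + 2 * \<alpha> * x / (1 - x\<^sup>2))) (at x)"
    by (intro has_vector_derivative_of_real)
      (simp add: has_real_derivative_iff_has_vector_derivative)
  then show ?thesis by (simp add: potential_deriv_def)
qed

theorem theorem2p5:
  fixes \<alpha> t :: real and P :: "nat \<Rightarrow> real poly" and h \<beta> :: "nat \<Rightarrow> real"
    and v' :: "complex \<Rightarrow> complex" and A B :: "nat \<Rightarrow> complex \<Rightarrow> complex"
  assumes "\<alpha> > -1"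
    and "monic_orthogonal_polys \<alpha> t P h"
  defines "\<beta> \<equiv> rec_coeff h"
    and "v' \<equiv> potential_deriv \<alpha> t"
    and "A \<equiv> ladder_A \<alpha> t \<beta>"
    and "B \<equiv> ladder_B t \<beta>"
  shows "(\<forall>x\<in>{-1<..<1}.
            ((\<lambda>x. complex_of_real (potential \<alpha> t x)) has_vector_derivative v' (complex_of_real x)) (at x)) \<and>
         (\<forall>n z. z \<noteq> 1 \<and> z \<noteq> -1 \<and> ladder_num \<alpha> t \<beta> n \<noteq> 0 \<longrightarrow>
            (A n z \<noteq> 0 \<longrightarrow>
               (deriv ^^ 2) (complex_eval (P n)) z
               - (v' z + deriv (A n) z / A n z) * deriv (complex_eval (P n)) z
               + (deriv (B n) z - B n z * (deriv (A n) z / A n z) + (\<Sum>j<n. A j z))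
                   * complex_eval (P n) z = 0) \<and>
            (\<Sum>j<n. A j z) =
               complex_of_real (2 * real n * t)
               + complex_of_real ((real n)\<^sup>2 - 2 * real n * (t - \<alpha>)
                     + 2 * t * \<beta> n * (2 * t + 1 - 2 * t * \<beta> (n + 1))) / (1 - z\<^sup>2)
               + complex_of_real (2 * t * (real n - 2 * t * \<beta> n) * (real n + 2 * \<alpha> - 2 * t * \<beta> n))
                   / (complex_of_real (ladder_num \<alpha> t \<beta> n) * (1 - z\<^sup>2)))"
proof -
  interpret pearson_orthogonal_family "weighted_integral \<alpha> t" P h \<alpha> t
    using assms(1,2) by (rule pearson_orthogonal_family_weighted_integral)
  show ?thesis
    unfolding v'_def A_def B_def \<beta>_def
    using has_vector_derivative_potential differential_equation sum_ladder_A_closed_form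
    by blast
qed

end
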